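(* Let $K\in M_N(\mathbb C)$ satisfy $K^*=-K$, and let $\alpha=q/2$. If $b(t)$, $t$ in an interval, is a continuously differentiable curve of positive elements of $M_N(\mathbb C)$ solving $$\dot b=b^{\alpha}K-Kb^{\alpha},$$ and $s\ge 1$, then $\|b(t)\|_s$ is constant, and the eigenvalues of $b(t)$ and their multiplicities do not depend on $t$. In particular the operator norm $\|b(t)\|$ is constant.
   Context: $p=2n\ge2$ is a fixed even integer and $q=p/(p-1)$ is its conjugate exponent. $\tau(x)=\frac1N\operatorname{Re}\operatorname{Tr}(x)$, $|x|=(x^*x)^{1/2}$, and $\|x\|_s=\tau(|x|^s)^{1/s}$. $b^\alpha$ denotes the positive power of the positive matrix $b$ via functional calculus. *)

theory Defs
  imports "HOL-Analysis.Analysis" "HOL-Computational_Algebra.Polynomial"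
begin

text \<open>Matrices in M_N(C) are rendered as complex^'n^'n with N = CARD('n).\<close>

definition adjm :: "complex^'n^'n \<Rightarrow> complex^'n^'n" where
  "adjm A = (\<chi> i j. cnj (A $ j $ i))"

definition hermitian :: "complex^'n^'n \<Rightarrow> bool" where
  "hermitian A \<longleftrightarrow> adjm A = A"

definition unitary :: "complex^'n^'n \<Rightarrow> bool" where
  "unitary U \<longleftrightarrow> U ** adjm U = mat 1 \<and> adjm U ** U = mat 1"

text \<open>Positive (= positive semidefinite) matrix.\<close>
definition positive :: "complex^'n^'n \<Rightarrow> bool" where
  "positive A \<longleftrightarrow> hermitian A \<and>
     (\<forall>v::complex^'n. Re (\<Sum>i\<in>UNIV. cnj (v $ i) * (A *v v) $ i) \<ge> 0)"

definition diagm :: "('n \<Rightarrow> complex) \<Rightarrow> complex^'n^'n" where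
  "diagm d = (\<chi> i j. if i = j then d i else 0)"

text \<open>Functional calculus b^a for a positive matrix b and real a > 0,
  via a unitary diagonalisation b = U diag(d) U^*, d \<ge> 0.\<close>
definition mpow :: "complex^'n^'n \<Rightarrow> real \<Rightarrow> complex^'n^'n" where
  "mpow b a = (THE c. \<exists>U d. unitary U \<and> (\<forall>i. d i \<ge> 0) \<and>
      b = U ** diagm (\<lambda>i. complex_of_real (d i)) ** adjm U \<and>
      c = U ** diagm (\<lambda>i. complex_of_real (d i powr a)) ** adjm U)"

definition mabs :: "complex^'n^'n \<Rightarrow> complex^'n^'n" where
  "mabs x = mpow (adjm x ** x) (1/2)"

definition tau :: "complex^'n^'n \<Rightarrow> real" where
  "tau x = Re (trace x) / real CARD('n)"

definition snorm :: "real \<Rightarrow> complex^'n^'n \<Rightarrow> real" where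
  "snorm s x = tau (mpow (mabs x) s) powr (1/s)"

definition opnorm :: "complex^'n^'n \<Rightarrow> real" where
  "opnorm A = onorm (\<lambda>v::complex^'n. A *v v)"

definition is_eigenvalue :: "complex^'n^'n \<Rightarrow> complex \<Rightarrow> bool" where
  "is_eigenvalue A c \<longleftrightarrow> (\<exists>v. v \<noteq> 0 \<and> A *v v = (\<chi> i. c * v $ i))"

definition charpoly :: "complex^'n^'n \<Rightarrow> complex poly" where
  "charpoly A = det (\<chi> i j. (if i = j then [:0, 1:] else 0) - [:A $ i $ j:])"

text \<open>Algebraic multiplicity of c as an eigenvalue of A.\<close>
definition eig_mult :: "complex^'n^'n \<Rightarrow> complex \<Rightarrow> nat" where
  "eig_mult A c = order c (charpoly A)"

end

theory Submission
  imports Defs "HOL-Computational_Algebra.Fundamental_Theorem_Algebra"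
begin

text \<open>
  Along the flow, \<open>d/dt tr(b\<^sup>k) = k tr(b\<^sup>k\<^sup>-\<^sup>1 (b\<^sup>\<alpha> K - K b\<^sup>\<alpha>)) = 0\<close>, because \<open>b\<^sup>\<alpha>\<close>
  commutes with \<open>b\<close> and the trace is cyclic. Hence all power sums of the eigenvalues of
  \<open>b(t)\<close> are constant in \<open>t\<close>, and finitely many reals are determined, with multiplicities,
  by their power sums. So the spectral decompositions of \<open>b(t\<^sub>1)\<close> and \<open>b(t\<^sub>2)\<close> differ
  only by a permutation of the eigenvalues, i.e. \<open>b(t\<^sub>2) = W b(t\<^sub>1) W\<^sup>*\<close> for a unitary \<open>W\<close>,
  and the \<open>s\<close>-norm, the eigenvalues, the characteristic polynomial and the operator norm
  are all invariant under unitary conjugation. Skew-adjointness of \<open>K\<close>, the value of \<open>\<alpha>\<close>,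
  continuity of the derivative and \<open>s \<ge> 1\<close> are not needed.
\<close>

section \<open>Adjoints and unitary matrices\<close>

lemma adjm_nth [simp]: "adjm A $ i $ j = cnj (A $ j $ i)"
  by (simp add: adjm_def)

lemma adjm_adjm [simp]: "adjm (adjm A) = A"
  by (simp add: vec_eq_iff)

lemma adjm_mult: "adjm (A ** B) = adjm B ** adjm A"
  by (simp add: vec_eq_iff matrix_matrix_mult_def mult.commute)

lemma diagm_nth [simp]: "diagm d $ i $ j = (if i = j then d i else 0)"
  by (simp add: diagm_def)

lemma mult_diagm_right: "(A ** diagm d) $ i $ j = A $ i $ j * d j"
  by (simp add: matrix_matrix_mult_def if_distrib if_distribR sum.delta' cong: if_cong)

lemma mult_diagm_left: "(diagm d ** A) $ i $ j = d i * A $ i $ j"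
  by (simp add: matrix_matrix_mult_def if_distrib if_distribR sum.delta cong: if_cong)

lemma adjm_diagm_of_real [simp]:
  "adjm (diagm (\<lambda>i. complex_of_real (d i))) = diagm (\<lambda>i. complex_of_real (d i))"
  by (simp add: vec_eq_iff)

lemma diagm_mult: "diagm d ** diagm e = diagm (\<lambda>i. d i * e i)"
  by (simp add: vec_eq_iff mult_diagm_left)

lemma trace_diagm: "trace (diagm d) = sum d UNIV"
  by (simp add: trace_def)

lemma unitary_adjm: "unitary U \<Longrightarrow> unitary (adjm U)"
  by (simp add: unitary_def)

lemma unitary_mult: "unitary U \<Longrightarrow> unitary V \<Longrightarrow> unitary (U ** V)"
  unfolding unitary_def adjm_mult by (metis matrix_mul_assoc matrix_mul_rid)

lemma unitary_right_inverse: "unitary U \<Longrightarrow> U ** adjm U = mat 1"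
  by (simp add: unitary_def)

lemma unitary_left_inverse: "unitary U \<Longrightarrow> adjm U ** U = mat 1"
  by (simp add: unitary_def)

lemma unitaryI: "adjm U ** U = mat 1 \<Longrightarrow> unitary U"
  unfolding unitary_def using matrix_left_right_inverse by blast

lemma unitary_conj_cancel: "unitary W \<Longrightarrow> adjm W ** (W ** A ** adjm W) ** W = A"
  by (metis matrix_mul_assoc matrix_mul_lid matrix_mul_rid unitary_left_inverse)

lemma unitary_vec_cancel: "unitary W \<Longrightarrow> adjm W *v (W *v v) = v"
  by (simp add: matrix_vector_mul_assoc unitary_left_inverse)

lemma trace_unitary_conj: "unitary U \<Longrightarrow> trace (U ** X ** adjm U) = trace X"
  by (metis matrix_mul_assoc matrix_mul_lid trace_mul_sym unitary_left_inverse)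

lemma matrix_add_rdistrib: "(A + B) ** C = A ** C + B ** (C::'a::semiring_1^'n^'m)"
  by (simp add: vec_eq_iff matrix_matrix_mult_def sum.distrib distrib_right)

lemma matrix_diff_rdistrib: "(A - B) ** C = A ** C - B ** (C::'a::ring_1^'n^'m)"
  by (simp add: vec_eq_iff matrix_matrix_mult_def sum_subtractf left_diff_distrib)

lemma matrix_diff_ldistrib: "C ** (A - B) = C ** A - C ** (B::'a::ring_1^'n^'m)"
  by (simp add: vec_eq_iff matrix_matrix_mult_def sum_subtractf right_diff_distrib)

section \<open>Spectral decompositions and the functional calculus\<close>

definition spectral_decomp :: "complex^'n^'n \<Rightarrow> complex^'n^'n \<Rightarrow> ('n \<Rightarrow> real) \<Rightarrow> bool" where
  "spectral_decomp b U d \<longleftrightarrow> unitary U \<and> (\<forall>i. d i \<ge> 0) \<and>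
      b = U ** diagm (\<lambda>i. complex_of_real (d i)) ** adjm U"

lemma spectral_decomp_functional_calculus_unique:
  assumes "spectral_decomp b U d" "spectral_decomp b V e"
  shows "U ** diagm (\<lambda>i. complex_of_real (f (d i))) ** adjm U =
         V ** diagm (\<lambda>i. complex_of_real (f (e i))) ** adjm V"
proof -
  let ?D = "diagm (\<lambda>i. complex_of_real (d i))"
  let ?E = "diagm (\<lambda>i. complex_of_real (e i))"
  let ?fD = "diagm (\<lambda>i. complex_of_real (f (d i)))"
  let ?fE = "diagm (\<lambda>i. complex_of_real (f (e i)))"
  have U: "unitary U" and V: "unitary V"
    and bU: "b = U ** ?D ** adjm U" and bV: "b = V ** ?E ** adjm V"
    using assms by (auto simp: spectral_decomp_def)
  define W where "W = adjm V ** U"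
  have "W ** ?D = adjm V ** b ** U"
    using bU unitary_left_inverse[OF U] unfolding W_def by (metis matrix_mul_assoc matrix_mul_rid)
  also have "\<dots> = ?E ** W"
    using bV unitary_left_inverse[OF V] unfolding W_def by (metis matrix_mul_assoc matrix_mul_lid)
  finally have WDE: "W ** ?D = ?E ** W" .
  \<comment> \<open>entrywise, \<open>W\<^sub>i\<^sub>j d\<^sub>j = e\<^sub>i W\<^sub>i\<^sub>j\<close>: so \<open>W\<^sub>i\<^sub>j = 0\<close> unless \<open>d\<^sub>j = e\<^sub>i\<close>, and then also \<open>f\<close> can be applied\<close>
  have "W $ i $ j * complex_of_real (f (d j)) = complex_of_real (f (e i)) * W $ i $ j" for i j
  proof -
    have "W $ i $ j * complex_of_real (d j) = complex_of_real (e i) * W $ i $ j"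
      using arg_cong[OF WDE, of "\<lambda>M. M $ i $ j"] by (simp add: mult_diagm_right mult_diagm_left)
    then have "W $ i $ j = 0 \<or> d j = e i"
      by (metis mult.commute mult_cancel_left of_real_eq_iff)
    then show ?thesis by auto
  qed
  then have WfDE: "W ** ?fD = ?fE ** W"
    by (simp add: vec_eq_iff mult_diagm_right mult_diagm_left)
  have "U ** ?fD ** adjm U = V ** (W ** ?fD) ** adjm U"
    unfolding W_def using unitary_right_inverse[OF V] by (metis matrix_mul_assoc matrix_mul_lid)
  also have "\<dots> = V ** ?fE ** (W ** adjm U)"
    by (simp add: WfDE matrix_mul_assoc)
  also have "W ** adjm U = adjm V"
    unfolding W_def using unitary_right_inverse[OF U] by (metis matrix_mul_assoc matrix_mul_rid)
  finally show ?thesis .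
qed

lemma mpow_eq:
  assumes "spectral_decomp b U d"
  shows "mpow b a = U ** diagm (\<lambda>i. complex_of_real (d i powr a)) ** adjm U"
  unfolding mpow_def
proof (rule the_equality)
  show "\<exists>V e. unitary V \<and> (\<forall>i. 0 \<le> e i) \<and> b = V ** diagm (\<lambda>i. complex_of_real (e i)) ** adjm V \<and>
      U ** diagm (\<lambda>i. complex_of_real (d i powr a)) ** adjm U =
      V ** diagm (\<lambda>i. complex_of_real (e i powr a)) ** adjm V"
    using assms by (auto simp: spectral_decomp_def)
next
  fix c assume "\<exists>V e. unitary V \<and> (\<forall>i. 0 \<le> e i) \<and> b = V ** diagm (\<lambda>i. complex_of_real (e i)) ** adjm V \<and>
      c = V ** diagm (\<lambda>i. complex_of_real (e i powr a)) ** adjm V"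
  then obtain V e where "spectral_decomp b V e"
      "c = V ** diagm (\<lambda>i. complex_of_real (e i powr a)) ** adjm V"
    by (auto simp: spectral_decomp_def)
  then show "c = U ** diagm (\<lambda>i. complex_of_real (d i powr a)) ** adjm U"
    using spectral_decomp_functional_calculus_unique[OF assms, where f = "\<lambda>x. x powr a"] by metis
qed

lemma spectral_decomp_conj:
  assumes "spectral_decomp b U d" "unitary W"
  shows "spectral_decomp (W ** b ** adjm W) (W ** U) d"
  using assms unfolding spectral_decomp_def
  by (auto simp: unitary_mult adjm_mult matrix_mul_assoc)

lemma mpow_conj:
  assumes "spectral_decomp b U d" "unitary W"
  shows "mpow (W ** b ** adjm W) a = W ** mpow b a ** adjm W"
  using mpow_eq[OF spectral_decomp_conj[OF assms]] mpow_eq[OF assms(1)]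
  by (simp add: adjm_mult matrix_mul_assoc)

lemma spectral_decomp_mpow:
  assumes "spectral_decomp b U d"
  shows "spectral_decomp (mpow b a) U (\<lambda>i. d i powr a)"
  using assms mpow_eq[OF assms] by (auto simp: spectral_decomp_def)

lemma spectral_decomp_mult:
  assumes "spectral_decomp b U d" "spectral_decomp c U e"
  shows "b ** c = U ** diagm (\<lambda>i. complex_of_real (d i * e i)) ** adjm U"
proof -
  let ?D = "diagm (\<lambda>i. complex_of_real (d i))"
  let ?E = "diagm (\<lambda>i. complex_of_real (e i))"
  have U: "unitary U" using assms by (simp add: spectral_decomp_def)
  have "b ** c = U ** ?D ** (adjm U ** U) ** ?E ** adjm U"
    using assms by (simp add: spectral_decomp_def matrix_mul_assoc)
  also have "\<dots> = U ** (?D ** ?E) ** adjm U"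
    by (simp add: unitary_left_inverse[OF U] matrix_mul_assoc)
  finally show ?thesis
    by (simp add: diagm_mult)
qed

lemma mpow_commute:
  assumes "spectral_decomp b U d"
  shows "mpow b a ** b = b ** mpow b a"
  using spectral_decomp_mult[OF spectral_decomp_mpow[OF assms] assms]
    spectral_decomp_mult[OF assms spectral_decomp_mpow[OF assms]]
  by (simp add: mult.commute)

section \<open>The spectral theorem for Hermitian matrices\<close>

definition cinner :: "complex^'n \<Rightarrow> complex^'n \<Rightarrow> complex" where
  "cinner v w = (\<Sum>i\<in>UNIV. cnj (v $ i) * w $ i)"

lemma cinner_adjm: "cinner v (A *v w) = cinner (adjm A *v v) w"
proof -
  have "cinner v (A *v w) = (\<Sum>i\<in>UNIV. \<Sum>j\<in>UNIV. cnj (v $ i) * A $ i $ j * w $ j)"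
    by (simp add: cinner_def matrix_vector_mult_def sum_distrib_left mult.assoc)
  also have "\<dots> = (\<Sum>j\<in>UNIV. \<Sum>i\<in>UNIV. cnj (v $ i) * A $ i $ j * w $ j)"
    by (rule sum.swap)
  also have "\<dots> = cinner (adjm A *v v) w"
    by (simp add: cinner_def matrix_vector_mult_def sum_distrib_right sum_distrib_left mult_ac)
  finally show ?thesis .
qed

lemma cinner_self: "cinner v v = complex_of_real (\<Sum>i\<in>UNIV. (cmod (v $ i))\<^sup>2)"
proof -
  have "cnj (v $ i) * v $ i = complex_of_real ((cmod (v $ i))\<^sup>2)" for i
    using complex_norm_square[of "v $ i"] by (simp add: mult.commute)
  then show ?thesis unfolding cinner_def of_real_sum by simp
qed

lemma cinner_self_eq_0: "cinner v v = 0 \<longleftrightarrow> v = 0"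
proof -
  have "(\<Sum>i\<in>UNIV. (cmod (v $ i))\<^sup>2) = 0 \<longleftrightarrow> (\<forall>i. v $ i = 0)"
    by (subst sum_nonneg_eq_0_iff) auto
  then show ?thesis unfolding cinner_self of_real_eq_0_iff by (simp add: vec_eq_iff)
qed

lemma cinner_scale_right [simp]: "cinner v (c *s w) = c * cinner v w"
  by (simp add: cinner_def sum_distrib_left mult_ac)

lemma cinner_scale_left [simp]: "cinner (c *s v) w = cnj c * cinner v w"
  by (simp add: cinner_def sum_distrib_left mult_ac)

lemma cinner_zero_right [simp]: "cinner v 0 = 0"
  by (simp add: cinner_def)

lemma cinner_add_right [simp]: "cinner v (w + z) = cinner v w + cinner v z"
  by (simp add: cinner_def sum.distrib distrib_left)

lemma cinner_diff_right [simp]: "cinner v (w - z) = cinner v w - cinner v z"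
  by (simp add: cinner_def sum_subtractf right_diff_distrib)

lemma cinner_sum_right: "cinner v (sum g S) = (\<Sum>s\<in>S. cinner v (g s))"
  by (induction S rule: infinite_finite_induct) (auto simp: cinner_def sum.distrib distrib_left)

lemma cinner_commute: "cinner w v = cnj (cinner v w)"
  by (simp add: cinner_def mult.commute)

lemma norm_eq_sqrt_cinner: "norm v = sqrt (Re (cinner v v))"
  by (simp add: norm_vec_def L2_set_def cinner_self)

lemma matrix_vector_sum: "A *v sum g S = (\<Sum>s\<in>S. A *v g s)"
  by (induction S rule: infinite_finite_induct) (auto simp: matrix_vector_right_distrib)

lemma scaleR_eq_of_real_scale: "(r::real) *\<^sub>R (v::complex^'n) = complex_of_real r *s v"
  unfolding vec_eq_iff vector_scaleR_component by (simp add: scaleR_conv_of_real)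

lemma scale_eq_real_combination:
  "(c::complex) *s (v::complex^'n) = Re c *\<^sub>R v + Im c *\<^sub>R (\<i> *s v)"
proof -
  have "c * z = Re c *\<^sub>R z + Im c *\<^sub>R (\<i> * z)" for z
    by (subst (1) complex_eq[of c]) (simp add: scaleR_conv_of_real algebra_simps)
  then show ?thesis by (simp add: vec_eq_iff)
qed

definition orthonormal_set :: "(complex^'n) set \<Rightarrow> bool" where
  "orthonormal_set B \<longleftrightarrow> finite B \<and> (\<forall>v\<in>B. \<forall>w\<in>B. cinner v w = (if v = w then 1 else 0))"

lemma orthonormal_set_not_spanning:
  assumes B: "orthonormal_set B" and card: "card B < CARD('n)"
  shows "\<exists>x::complex^'n. x \<noteq> 0 \<and> (\<forall>v\<in>B. cinner v x = 0)"
proof -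
  have fin: "finite B" using B by (simp add: orthonormal_set_def)
  \<comment> \<open>over \<open>\<real>\<close>, \<open>B\<close> and \<open>\<i> B\<close> span at most \<open>2 card B < 2 CARD('n)\<close> dimensions\<close>
  define T where "T = B \<union> (\<lambda>v. \<i> *s v) ` B"
  have "card T \<le> card B + card B"
    unfolding T_def using card_Un_le[of B "(\<lambda>v. \<i> *s v) ` B"] card_image_le[OF fin, of "\<lambda>v. \<i> *s v"]
    by linarith
  also have "\<dots> < DIM(complex^'n)" using card by simp
  finally have "span T \<noteq> UNIV"
    using dim_le_card[of UNIV T] fin by (auto simp: T_def)
  then obtain y where y: "y \<notin> span T" by auto
  define x where "x = y - (\<Sum>v\<in>B. cinner v y *s v)"
  have "(\<Sum>v\<in>B. cinner v y *s v) \<in> span T"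
  proof (rule span_sum)
    fix v assume "v \<in> B"
    then have "v \<in> T" "\<i> *s v \<in> T" by (auto simp: T_def)
    then show "cinner v y *s v \<in> span T"
      by (subst scale_eq_real_combination) (intro span_add span_scale span_base)
  qed
  then have "x \<noteq> 0" using y by (auto simp: x_def)
  moreover have "cinner w x = 0" if "w \<in> B" for w
  proof -
    have "(\<Sum>v\<in>B. cinner w (cinner v y *s v)) = (\<Sum>v\<in>B. if v = w then cinner w y else 0)"
      using B that by (intro sum.cong) (auto simp: orthonormal_set_def)
    also have "\<dots> = cinner w y" using fin that by simp
    finally show ?thesis by (simp add: x_def cinner_sum_right)
  qed
  ultimately show ?thesis by blast
qed

definition poly_apply :: "complex^'n^'n \<Rightarrow> complex poly \<Rightarrow> complex^'n \<Rightarrow> complex^'n" where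
  "poly_apply A p x = (\<Sum>i\<le>degree p. coeff p i *s (((*v) A) ^^ i) x)"

lemma poly_apply_degree_bound:
  assumes "degree p \<le> M"
  shows "poly_apply A p x = (\<Sum>i\<le>M. coeff p i *s (((*v) A) ^^ i) x)"
  unfolding poly_apply_def
  by (rule sum.mono_neutral_left) (use assms in \<open>auto simp: coeff_eq_0\<close>)

lemma poly_apply_add: "poly_apply A (p + q) x = poly_apply A p x + poly_apply A q x"
proof -
  let ?M = "max (degree p) (degree q)"
  have "degree (p + q) \<le> ?M" by (rule degree_add_le) auto
  then show ?thesis
    by (simp add: poly_apply_degree_bound[of _ ?M] sum.distrib vector_sadd_rdistrib)
qed

lemma poly_apply_diff: "poly_apply A (p - q) x = poly_apply A p x - poly_apply A q x"
  using poly_apply_add[of A "p - q" q x] by simp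

lemma poly_apply_zero [simp]: "poly_apply A 0 x = 0"
  by (simp add: poly_apply_def)

lemma poly_apply_sum: "poly_apply A (sum g S) x = (\<Sum>s\<in>S. poly_apply A (g s) x)"
  by (induction S rule: infinite_finite_induct) (auto simp: poly_apply_add)

lemma poly_apply_smult: "poly_apply A (smult c p) x = c *s poly_apply A p x"
  by (simp add: poly_apply_degree_bound[OF degree_smult_le] poly_apply_def vec_eq_iff
      sum_distrib_left sum_component mult.assoc)

lemma poly_apply_const: "poly_apply A [:c:] x = c *s x"
  by (simp add: poly_apply_def)

lemma poly_apply_monom: "poly_apply A (monom c j) x = c *s (((*v) A) ^^ j) x"
proof -
  have "poly_apply A (monom c j) x = (\<Sum>i\<le>j. coeff (monom c j) i *s (((*v) A) ^^ i) x)"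
    by (rule poly_apply_degree_bound) (simp add: degree_monom_le)
  also have "\<dots> = (\<Sum>i\<le>j. if j = i then c *s (((*v) A) ^^ i) x else 0)"
    by (rule sum.cong) (auto simp: coeff_monom)
  finally show ?thesis by simp
qed

lemma poly_apply_pCons_0: "poly_apply A (pCons 0 p) x = A *v poly_apply A p x"
proof -
  have "poly_apply A (pCons 0 p) x =
      (\<Sum>i\<le>Suc (degree p). coeff (pCons 0 p) i *s (((*v) A) ^^ i) x)"
    by (rule poly_apply_degree_bound) (simp add: degree_pCons_le)
  also have "\<dots> = (\<Sum>i\<le>degree p. coeff p i *s (((*v) A) ^^ Suc i) x)"
    by (subst sum.atMost_Suc_shift) simp
  also have "\<dots> = A *v poly_apply A p x"
    by (simp add: poly_apply_def matrix_vector_sum vector_scalar_commute)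
  finally show ?thesis .
qed

lemma poly_apply_linear_factor:
  "poly_apply A ([:-r, 1:] * q) x = A *v poly_apply A q x - r *s poly_apply A q x"
proof -
  have "[:-r, 1:] * q = pCons 0 q - smult r q"
    by (simp add: mult_pCons_left)
  then show ?thesis by (simp add: poly_apply_diff poly_apply_pCons_0 poly_apply_smult)
qed

lemma poly_apply_closed:
  assumes S0: "0 \<in> S" and Sadd: "\<And>x y. x \<in> S \<Longrightarrow> y \<in> S \<Longrightarrow> x + y \<in> S"
    and Sscale: "\<And>c x. x \<in> S \<Longrightarrow> c *s x \<in> S" and SA: "\<And>x. x \<in> S \<Longrightarrow> A *v x \<in> S"
    and x: "x \<in> S"
  shows "poly_apply A p x \<in> S"
proof -
  have power: "(((*v) A) ^^ i) x \<in> S" for i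
    by (induction i) (auto simp: x SA)
  have "(\<Sum>i\<in>F. coeff p i *s (((*v) A) ^^ i) x) \<in> S" if "finite F" for F
    using that by (induction F rule: finite_induct) (auto simp: S0 Sadd Sscale power)
  then show ?thesis unfolding poly_apply_def by simp
qed

lemma exists_annihilating_poly:
  fixes A :: "complex^'n^'n"
  shows "\<exists>p. p \<noteq> 0 \<and> poly_apply A p x = 0"
proof -
  define g where "g i = (((*v) A) ^^ i) x" for i
  define M where "M = 2 * CARD('n)"
  show ?thesis
  proof (cases "inj_on g {..M}")
    case False
    then obtain i j where ij: "i \<noteq> j" "g i = g j"
      unfolding inj_on_def by blast
    define p where "p = monom (1::complex) j - monom 1 i"
    have "coeff p j = 1" using ij by (simp add: p_def coeff_monom)
    moreover have "poly_apply A p x = 0"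
      using ij by (simp add: p_def poly_apply_diff poly_apply_monom g_def)
    ultimately show ?thesis by (metis coeff_0 zero_neq_one)
  next
    case True
    \<comment> \<open>\<open>M + 1\<close> distinct vectors in a real space of dimension \<open>M\<close> are linearly dependent\<close>
    let ?G = "g ` {..M}"
    have "card ?G > DIM(complex^'n)" using True by (simp add: card_image M_def)
    then have "dependent ?G" using independent_bound[of ?G] by linarith
    then obtain T u where T: "finite T" "T \<subseteq> ?G" "(\<Sum>v\<in>T. u v *\<^sub>R v) = 0" "\<exists>v\<in>T. u v \<noteq> 0"
      unfolding dependent_explicit by blast
    define J where "J = {i\<in>{..M}. g i \<in> T}"
    have TJ: "T = g ` J" using T(2) by (auto simp: J_def)
    have injJ: "inj_on g J" using True by (rule inj_on_subset) (auto simp: J_def)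
    define p where "p = (\<Sum>j\<in>J. monom (complex_of_real (u (g j))) j)"
    have "poly_apply A p x = (\<Sum>j\<in>J. u (g j) *\<^sub>R g j)"
      by (simp add: p_def poly_apply_sum poly_apply_monom g_def scaleR_eq_of_real_scale)
    also have "\<dots> = (\<Sum>v\<in>T. u v *\<^sub>R v)"
      unfolding TJ by (rule sum.reindex[OF injJ, symmetric, unfolded comp_def])
    finally have "poly_apply A p x = 0" using T(3) by simp
    moreover obtain j0 where j0: "j0 \<in> J" "u (g j0) \<noteq> 0" using T(4) TJ by blast
    moreover have "coeff p j0 = complex_of_real (u (g j0))"
      using j0 by (simp add: p_def coeff_sum coeff_monom J_def)
    ultimately show ?thesis by (metis coeff_0 of_real_eq_0_iff)
  qed
qed

lemma invariant_subspace_has_eigenvector: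
  fixes A :: "complex^'n^'n"
  assumes S0: "0 \<in> S" and Sadd: "\<And>x y. x \<in> S \<Longrightarrow> y \<in> S \<Longrightarrow> x + y \<in> S"
    and Sscale: "\<And>c x. x \<in> S \<Longrightarrow> c *s x \<in> S" and SA: "\<And>x. x \<in> S \<Longrightarrow> A *v x \<in> S"
    and x: "x \<in> S" "x \<noteq> 0"
  shows "\<exists>y\<in>S. y \<noteq> 0 \<and> (\<exists>\<mu>. A *v y = \<mu> *s y)"
proof -
  \<comment> \<open>split linear factors off an annihilating polynomial until a factor stops killing its argument\<close>
  have "\<exists>y\<in>S. y \<noteq> 0 \<and> (\<exists>\<mu>. A *v y = \<mu> *s y)" if "p \<noteq> 0" "poly_apply A p x = 0" for p
    using that
  proof (induction "degree p" arbitrary: p rule: less_induct)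
    case less
    show ?case
    proof (cases "degree p = 0")
      case True
      then obtain c where "p = [:c:]" "c \<noteq> 0" using less.prems by (metis degree_eq_zeroE pCons_0_0)
      then have "x = 0" using less.prems by (simp add: poly_apply_const vec_eq_iff)
      with x show ?thesis by simp
    next
      case False
      then obtain r where "poly p r = 0"
        using fundamental_theorem_of_algebra[of p] constant_degree[of p] by metis
      then obtain q where pq: "p = [:-r, 1:] * q" by (metis dvdE poly_eq_0_iff_dvd)
      have q0: "q \<noteq> 0" using less.prems pq by auto
      have dq: "degree q < degree p"
        using pq q0 degree_mult_eq[of "[:-r,1:]" q] by (simp del: mult_pCons_left)
      define y where "y = poly_apply A q x"
      show ?thesis
      proof (cases "y = 0")
        case True
        then show ?thesis using less.hyps[OF dq q0] by (simp add: y_def)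
      next
        case False
        have "A *v y = r *s y"
          using less.prems pq poly_apply_linear_factor[of A r q x] by (simp add: y_def del: mult_pCons_left)
        moreover have "y \<in> S" unfolding y_def by (rule poly_apply_closed[OF S0 Sadd Sscale SA x(1)])
        ultimately show ?thesis using False by blast
      qed
    qed
  qed
  then show ?thesis using exists_annihilating_poly by blast
qed

lemma hermitian_eigenvalue_real:
  assumes herm: "adjm A = A" and y: "A *v y = \<mu> *s y" "y \<noteq> 0"
  shows "\<mu> = complex_of_real (Re \<mu>)"
proof -
  have "\<mu> * cinner y y = cinner y (A *v y)" using y by simp
  also have "\<dots> = cinner (A *v y) y" by (simp add: cinner_adjm herm)
  also have "\<dots> = cnj \<mu> * cinner y y" using y by simp
  finally have "\<mu> = cnj \<mu>" using y cinner_self_eq_0[of y] by simp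
  then show ?thesis by (metis Reals_cnj_iff complex_is_Real_iff of_real_Re)
qed

lemma exists_unit_multiple:
  assumes "y \<noteq> 0"
  shows "\<exists>c. cinner (c *s y) (c *s y) = 1"
proof -
  define r where "r = (\<Sum>i\<in>UNIV. (cmod (y $ i))\<^sup>2)"
  have "r \<ge> 0" by (simp add: r_def sum_nonneg)
  moreover have "r \<noteq> 0" using assms unfolding r_def by (metis cinner_self cinner_self_eq_0 of_real_0)
  ultimately have unit: "1 / sqrt r * (1 / sqrt r) * r = 1" by simp
  define c where "c = complex_of_real (1 / sqrt r)"
  have "cinner (c *s y) (c *s y) = cnj c * c * complex_of_real r"
    by (simp add: cinner_self[of y, folded r_def] mult.assoc)
  also have "\<dots> = complex_of_real (1 / sqrt r * (1 / sqrt r) * r)"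
    by (simp only: c_def complex_cnj_complex_of_real of_real_mult)
  also have "\<dots> = 1" by (simp only: unit of_real_1)
  finally show ?thesis by blast
qed

definition orthonormal_eigenvectors :: "complex^'n^'n \<Rightarrow> (complex^'n) set \<Rightarrow> bool" where
  "orthonormal_eigenvectors A B \<longleftrightarrow>
     orthonormal_set B \<and> (\<forall>v\<in>B. \<exists>l::real. A *v v = complex_of_real l *s v)"

lemma orthonormal_eigenvectors_extend:
  fixes A :: "complex^'n^'n"
  assumes herm: "adjm A = A" and B: "orthonormal_eigenvectors A B" and card: "card B < CARD('n)"
  shows "\<exists>B'. orthonormal_eigenvectors A B' \<and> card B' = Suc (card B)"
proof -
  have fin: "finite B" and onB: "orthonormal_set B"
    using B by (simp_all add: orthonormal_eigenvectors_def orthonormal_set_def)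
  obtain x where x: "x \<noteq> 0" "\<forall>v\<in>B. cinner v x = 0"
    using orthonormal_set_not_spanning[OF onB card] by blast
  \<comment> \<open>the orthogonal complement of eigenvectors of a Hermitian matrix is invariant\<close>
  define S where "S = {x. \<forall>v\<in>B. cinner v x = 0}"
  have SA: "A *v x \<in> S" if "x \<in> S" for x
  proof -
    have "cinner v (A *v x) = 0" if v: "v \<in> B" for v
    proof -
      obtain l :: real where "A *v v = complex_of_real l *s v"
        using B v unfolding orthonormal_eigenvectors_def by blast
      then show ?thesis using v \<open>x \<in> S\<close> by (simp add: cinner_adjm herm S_def)
    qed
    then show ?thesis by (simp add: S_def)
  qed
  obtain y \<mu> where y: "y \<in> S" "y \<noteq> 0" "A *v y = \<mu> *s y"
    using invariant_subspace_has_eigenvector[of S A x] x SA by (auto simp: S_def)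
  obtain c where zz: "cinner (c *s y) (c *s y) = 1" using exists_unit_multiple[OF y(2)] by blast
  define z where "z = c *s y"
  have Az: "A *v z = complex_of_real (Re \<mu>) *s z"
    using hermitian_eigenvalue_real[OF herm y(3,2)] y(3)
    by (simp add: z_def vector_scalar_commute vec_eq_iff mult_ac)
  have zB: "cinner v z = 0" "cinner z v = 0" if "v \<in> B" for v
    using y(1) that cinner_commute[of z v] by (simp_all add: z_def S_def)
  have zz: "cinner z z = 1" unfolding z_def by (rule zz)
  then have "z \<notin> B" using zB(1)[of z] by auto
  have "orthonormal_eigenvectors A (insert z B)"
    using B zz Az zB fin unfolding orthonormal_eigenvectors_def orthonormal_set_def by auto
  moreover have "card (insert z B) = Suc (card B)" using fin \<open>z \<notin> B\<close> by simp
  ultimately show ?thesis by blast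
qed

lemma hermitian_orthonormal_eigenbasis:
  fixes A :: "complex^'n^'n"
  assumes herm: "adjm A = A"
  shows "\<exists>B. orthonormal_eigenvectors A B \<and> card B = CARD('n)"
proof -
  have "\<exists>B. orthonormal_eigenvectors A B \<and> card B = k" if "k \<le> CARD('n)" for k
    using that
  proof (induction k)
    case 0
    have "orthonormal_eigenvectors A {}" by (simp add: orthonormal_eigenvectors_def orthonormal_set_def)
    then show ?case by auto
  next
    case (Suc k)
    then show ?case using orthonormal_eigenvectors_extend[OF herm] by fastforce
  qed
  then show ?thesis by blast
qed

lemma positive_spectral_decomp:
  fixes A :: "complex^'n^'n"
  assumes pos: "positive A"
  shows "\<exists>U d. spectral_decomp A U d"
proof -
  have "adjm A = A" using pos by (simp add: positive_def hermitian_def)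
  then obtain B where B: "orthonormal_eigenvectors A B" "card B = CARD('n)"
    using hermitian_orthonormal_eigenbasis by blast
  have fin: "finite B" using B by (simp add: orthonormal_eigenvectors_def orthonormal_set_def)
  obtain h where h: "bij_betw h (UNIV::'n set) B"
    using finite_same_card_bij[of "UNIV::'n set" B] fin B(2) by auto
  have hB: "h i \<in> B" for i using h by (auto simp: bij_betw_def)
  have hinj: "h i = h j \<longleftrightarrow> i = j" for i j using h by (auto simp: bij_betw_def inj_on_def)
  define d where "d i = (SOME l::real. A *v h i = complex_of_real l *s h i)" for i
  have hd: "A *v h i = complex_of_real (d i) *s h i" for i
  proof -
    have "\<exists>l::real. A *v h i = complex_of_real l *s h i"
      using B(1) hB[of i] by (auto simp: orthonormal_eigenvectors_def)
    then show ?thesis unfolding d_def by (rule someI_ex)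
  qed
  have hh: "cinner (h i) (h j) = (if i = j then 1 else 0)" for i j
    using B(1) hB[of i] hB[of j] hinj[of i j]
    by (auto simp: orthonormal_eigenvectors_def orthonormal_set_def)
  define U :: "complex^'n^'n" where "U = (\<chi> r c. h c $ r)"
  have "adjm U ** U = mat 1"
    by (simp add: vec_eq_iff matrix_matrix_mult_def U_def mat_def hh[unfolded cinner_def])
  then have U: "unitary U" by (rule unitaryI)
  let ?D = "diagm (\<lambda>i. complex_of_real (d i))"
  have "(A ** U) $ r $ c = (U ** ?D) $ r $ c" for r c
  proof -
    have "(A ** U) $ r $ c = (A *v h c) $ r"
      by (simp add: matrix_matrix_mult_def matrix_vector_mult_def U_def)
    also have "\<dots> = (U ** ?D) $ r $ c"
      by (simp add: hd mult_diagm_right U_def mult.commute)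
    finally show ?thesis .
  qed
  then have "A ** U = U ** ?D" by (simp add: vec_eq_iff)
  then have "A = U ** ?D ** adjm U"
    by (metis U matrix_mul_assoc matrix_mul_rid unitary_right_inverse)
  moreover have "d i \<ge> 0" for i
  proof -
    have "0 \<le> Re (cinner (h i) (A *v h i))"
      using pos unfolding positive_def cinner_def by blast
    also have "\<dots> = d i" using hh[of i i] by (simp add: hd)
    finally show ?thesis .
  qed
  ultimately show ?thesis using U unfolding spectral_decomp_def by blast
qed

section \<open>Traces of powers are constant along the flow\<close>

definition matpow :: "complex^'n^'n \<Rightarrow> nat \<Rightarrow> complex^'n^'n" where
  "matpow X k = (((**) X) ^^ k) (mat 1)"

lemma matpow_0 [simp]: "matpow X 0 = mat 1"
  by (simp add: matpow_def)

lemma matpow_Suc: "matpow X (Suc k) = X ** matpow X k"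
  by (simp add: matpow_def)

lemma matpow_commute: "Y ** X = X ** Y \<Longrightarrow> Y ** matpow X k = matpow X k ** Y"
  by (induction k) (simp_all add: matpow_Suc matrix_mul_assoc, metis matrix_mul_assoc)

lemma matpow_spectral_decomp:
  assumes "spectral_decomp b U d"
  shows "spectral_decomp (matpow b k) U (\<lambda>i. d i ^ k)"
proof (induction k)
  case 0
  have "diagm (\<lambda>i. complex_of_real (d i ^ 0)) = mat 1"
    by (simp add: vec_eq_iff mat_def)
  then show ?case using assms by (simp add: spectral_decomp_def unitary_right_inverse)
next
  case (Suc k)
  then show ?case
    using spectral_decomp_mult[OF assms Suc] assms by (simp add: matpow_Suc spectral_decomp_def)
qed

lemma trace_matpow_spectral_decomp:
  assumes "spectral_decomp b U d"
  shows "trace (matpow b k) = complex_of_real (\<Sum>i\<in>UNIV. d i ^ k)"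
  using matpow_spectral_decomp[OF assms, of k]
  by (simp add: spectral_decomp_def trace_unitary_conj trace_diagm)

lemma bounded_bilinear_matrix_mult: "bounded_bilinear (\<lambda>A B::complex^'n^'n. A ** B)"
proof -
  have "bilinear (\<lambda>A B::complex^'n^'n. A ** B)"
    unfolding bilinear_def
    by (auto intro!: linearI simp: matrix_add_ldistrib matrix_add_rdistrib scalar_matrix_assoc matrix_scalar_ac)
  then show ?thesis by (simp add: bilinear_conv_bounded_bilinear)
qed

lemma trace_scaleR: "trace (r *\<^sub>R (A::complex^'n^'n)) = r *\<^sub>R trace A"
  by (simp add: trace_def scaleR_sum_right)

lemma bounded_linear_trace: "bounded_linear (\<lambda>A::complex^'n^'n. trace A)"
proof -
  have "linear (\<lambda>A::complex^'n^'n. trace A)"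
    by (intro linearI) (simp_all add: trace_add trace_scaleR)
  then show ?thesis by (simp add: linear_conv_bounded_linear)
qed

text \<open>The derivative of \<open>t \<mapsto> b(t)\<^sup>k\<close> at a point where \<open>b = B\<close> and \<open>b' = M\<close>.\<close>

fun matpow_deriv :: "complex^'n^'n \<Rightarrow> complex^'n^'n \<Rightarrow> nat \<Rightarrow> complex^'n^'n" where
  "matpow_deriv B M 0 = 0"
| "matpow_deriv B M (Suc k) = B ** matpow_deriv B M k + M ** matpow B k"

lemma has_vector_derivative_matpow:
  assumes "(b has_vector_derivative M) (at t within I)"
  shows "((\<lambda>s. matpow (b s) k) has_vector_derivative matpow_deriv (b t) M k) (at t within I)"
proof (induction k)
  case (Suc k)
  show ?case
    using bounded_bilinear.has_vector_derivative[OF bounded_bilinear_matrix_mult assms Suc.IH]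
    by (simp add: matpow_Suc)
qed (simp add: matpow_def)

lemma trace_matpow_deriv:
  assumes "X ** B = B ** X"
  shows "trace (X ** matpow_deriv B M (Suc k)) = of_nat (Suc k) * trace (X ** matpow B k ** M)"
  using assms
proof (induction k arbitrary: X)
  case 0
  then show ?case by (simp add: matrix_mul_assoc)
next
  case (Suc k)
  let ?P = "matpow B (Suc k)"
  have "(X ** B) ** B = B ** (X ** B)" using Suc.prems by (metis matrix_mul_assoc)
  then have "trace (X ** (B ** matpow_deriv B M (Suc k))) = of_nat (Suc k) * trace (X ** ?P ** M)"
    using Suc.IH by (simp add: matrix_mul_assoc matpow_Suc)
  moreover have "trace (X ** (M ** ?P)) = trace (X ** ?P ** M)"
    by (metis Suc.prems matpow_commute matrix_mul_assoc trace_mul_sym)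
  ultimately show ?case
    by (simp add: matrix_add_ldistrib trace_add algebra_simps)
qed

lemma trace_matpow_deriv_commutator:
  assumes "c ** B = B ** c"
  shows "trace (matpow_deriv B (c ** K - K ** c) k) = 0"
proof (cases k)
  case (Suc j)
  have "trace (matpow B j ** (c ** K)) = trace (matpow B j ** (K ** c))"
    by (metis assms matpow_commute matrix_mul_assoc trace_mul_sym)
  then show ?thesis
    using trace_matpow_deriv[of "mat 1" B "c ** K - K ** c" j] Suc
    by (simp add: matrix_diff_ldistrib trace_sub)
qed (simp add: trace_def)

lemma trace_matpow_constant:
  fixes b c :: "real \<Rightarrow> complex^'n^'n"
  assumes I: "is_interval I"
    and comm: "\<forall>t\<in>I. c t ** b t = b t ** c t"
    and deriv: "\<forall>t\<in>I. (b has_vector_derivative (c t ** K - K ** c t)) (at t within I)"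
    and t1: "t1 \<in> I" and t2: "t2 \<in> I"
  shows "trace (matpow (b t1) k) = trace (matpow (b t2) k)"
proof -
  have "\<exists>C. \<forall>t\<in>I. trace (matpow (b t) k) = C"
  proof (rule has_derivative_zero_constant)
    show "convex I" using I by (rule is_interval_convex)
  next
    fix t assume t: "t \<in> I"
    let ?D = "matpow_deriv (b t) (c t ** K - K ** c t) k"
    have "((\<lambda>s. matpow (b s) k) has_derivative (\<lambda>h. h *\<^sub>R ?D)) (at t within I)"
      using has_vector_derivative_matpow[OF deriv[rule_format, OF t]]
      by (simp add: has_vector_derivative_def)
    from bounded_linear.has_derivative[OF bounded_linear_trace this]
    show "((\<lambda>s. trace (matpow (b s) k)) has_derivative (\<lambda>h. 0)) (at t within I)"
      using trace_matpow_deriv_commutator[of "c t" "b t" K k] comm t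
      by (simp add: trace_scaleR)
  qed
  then show ?thesis using t1 t2 by auto
qed

section \<open>Power sums determine the spectrum\<close>

lemma sum_poly_eq_if_power_sums_eq:
  fixes d e :: "'a::finite \<Rightarrow> real"
  assumes "\<forall>k. (\<Sum>i\<in>UNIV. d i ^ k) = (\<Sum>i\<in>UNIV. e i ^ k)"
  shows "(\<Sum>i\<in>UNIV. poly f (d i)) = (\<Sum>i\<in>UNIV. poly f (e i))"
proof -
  have "(\<Sum>i\<in>UNIV. poly f (d i)) = (\<Sum>j\<le>degree f. coeff f j * (\<Sum>i\<in>UNIV. d i ^ j))"
    by (simp add: poly_altdef sum_distrib_left) (rule sum.swap)
  also have "\<dots> = (\<Sum>j\<le>degree f. coeff f j * (\<Sum>i\<in>UNIV. e i ^ j))"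
    using assms by simp
  also have "\<dots> = (\<Sum>i\<in>UNIV. poly f (e i))"
    by (simp add: poly_altdef sum_distrib_left) (rule sum.swap)
  finally show ?thesis .
qed

lemma card_fiber_eq_if_power_sums_eq:
  fixes d e :: "'a::finite \<Rightarrow> real"
  assumes power_sums: "\<forall>k. (\<Sum>i\<in>UNIV. d i ^ k) = (\<Sum>i\<in>UNIV. e i ^ k)"
  shows "card {i. d i = l} = card {i. e i = l}"
proof -
  \<comment> \<open>a polynomial vanishing on all values of \<open>d\<close> and \<open>e\<close> except \<open>l\<close> counts the preimages of \<open>l\<close>\<close>
  define F where "F = range d \<union> range e"
  define g where "g = (\<Prod>\<mu>\<in>F - {l}. [:-\<mu>, 1:])"
  have poly_g: "poly g x = (\<Prod>\<mu>\<in>F - {l}. x - \<mu>)" for x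
    by (simp add: g_def poly_prod)
  have gl: "poly g l \<noteq> 0" by (simp add: poly_g F_def)
  have count: "(\<Sum>i\<in>UNIV. poly g (h i)) = real (card {i. h i = l}) * poly g l"
    if "range h \<subseteq> F" for h :: "'a \<Rightarrow> real"
  proof -
    have "poly g (h i) = (if h i = l then poly g l else 0)" for i
      using that by (auto simp: poly_g F_def prod_zero_iff)
    then have "(\<Sum>i\<in>UNIV. poly g (h i)) = (\<Sum>i\<in>{i. h i = l}. poly g l)"
      by (simp add: sum.If_cases)
    then show ?thesis by simp
  qed
  have "real (card {i. d i = l}) * poly g l = (\<Sum>i\<in>UNIV. poly g (d i))"
    using count[of d] by (simp add: F_def)
  also have "\<dots> = (\<Sum>i\<in>UNIV. poly g (e i))"
    by (rule sum_poly_eq_if_power_sums_eq[OF power_sums])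
  also have "\<dots> = real (card {i. e i = l}) * poly g l"
    using count[of e] by (simp add: F_def)
  finally show ?thesis using gl by simp
qed

lemma exists_inj_reindex_if_card_fibers_eq:
  fixes d e :: "'a::finite \<Rightarrow> real"
  assumes "\<And>l. card {i. d i = l} = card {i. e i = l}"
  shows "\<exists>\<sigma>. inj \<sigma> \<and> (\<forall>i. e i = d (\<sigma> i))"
proof -
  have "\<forall>l. \<exists>f. bij_betw f {i. e i = l} {i. d i = l}"
    using assms by (metis finite_same_card_bij finite)
  then obtain F where F: "\<And>l. bij_betw (F l) {i. e i = l} {i. d i = l}"
    by metis
  define \<sigma> where "\<sigma> i = F (e i) i" for i
  have de: "d (\<sigma> i) = e i" for i
    using F[of "e i"] unfolding \<sigma>_def bij_betw_def by auto
  have "inj \<sigma>"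
  proof (rule injI)
    fix i j assume eq: "\<sigma> i = \<sigma> j"
    then have "e i = e j" using de[of i] de[of j] by simp
    moreover have "inj_on (F (e i)) {k. e k = e i}" using F[of "e i"] by (simp add: bij_betw_def)
    ultimately show "i = j" using eq by (auto simp: \<sigma>_def inj_on_def)
  qed
  then show ?thesis using de by auto
qed

definition perm_matrix :: "('n \<Rightarrow> 'n) \<Rightarrow> complex^'n^'n" where
  "perm_matrix \<sigma> = (\<chi> r c. if r = \<sigma> c then 1 else 0)"

lemma perm_matrix_conj_diagm:
  assumes "inj \<sigma>"
  shows "adjm (perm_matrix \<sigma>) ** diagm d ** perm_matrix \<sigma> = diagm (d \<circ> \<sigma>)"
proof -
  have "(adjm (perm_matrix \<sigma>) ** diagm d ** perm_matrix \<sigma>) $ i $ j = diagm (d \<circ> \<sigma>) $ i $ j"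
    for i j
  proof -
    have "(adjm (perm_matrix \<sigma>) ** diagm d ** perm_matrix \<sigma>) $ i $ j =
        (\<Sum>k\<in>UNIV. cnj (perm_matrix \<sigma> $ k $ i) * d k * perm_matrix \<sigma> $ k $ j)"
      by (simp add: matrix_matrix_mult_def[of "_ ** diagm d"] mult_diagm_right)
    also have "\<dots> = (\<Sum>k\<in>UNIV. if k = \<sigma> i then (if \<sigma> i = \<sigma> j then d (\<sigma> i) else 0) else 0)"
      by (rule sum.cong) (auto simp: perm_matrix_def)
    also have "\<dots> = diagm (d \<circ> \<sigma>) $ i $ j"
      using assms by (simp add: inj_eq)
    finally show ?thesis .
  qed
  then show ?thesis by (simp add: vec_eq_iff)
qed

lemma unitary_perm_matrix:
  assumes "inj \<sigma>"
  shows "unitary (perm_matrix \<sigma>)"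
proof (rule unitaryI)
  have one: "diagm (\<lambda>_. 1) = (mat 1 :: complex^'n^'n)"
    by (simp add: vec_eq_iff mat_def)
  show "adjm (perm_matrix \<sigma>) ** perm_matrix \<sigma> = mat 1"
    using perm_matrix_conj_diagm[OF assms, of "\<lambda>_. 1"] by (simp only: one comp_def matrix_mul_rid)
qed

lemma spectral_decomp_reindex:
  assumes b: "spectral_decomp b U d" and \<sigma>: "inj \<sigma>"
  shows "spectral_decomp b (U ** perm_matrix \<sigma>) (d \<circ> \<sigma>)"
proof -
  let ?P = "perm_matrix \<sigma>"
  let ?D = "diagm (\<lambda>i. complex_of_real (d i))"
  have P: "unitary ?P" using unitary_perm_matrix[OF \<sigma>] .
  have "b = U ** (?P ** (adjm ?P ** ?D ** ?P) ** adjm ?P) ** adjm U"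
    using b unitary_conj_cancel[OF unitary_adjm[OF P], of ?D] by (simp add: spectral_decomp_def)
  also have "\<dots> = (U ** ?P) ** diagm (\<lambda>i. complex_of_real ((d \<circ> \<sigma>) i)) ** adjm (U ** ?P)"
    using perm_matrix_conj_diagm[OF \<sigma>, of "\<lambda>i. complex_of_real (d i)"]
    by (simp add: adjm_mult matrix_mul_assoc comp_def)
  finally show ?thesis
    using b P by (auto simp: spectral_decomp_def unitary_mult)
qed

definition unitarily_similar :: "complex^'n^'n \<Rightarrow> complex^'n^'n \<Rightarrow> bool" where
  "unitarily_similar A B \<longleftrightarrow> (\<exists>W. unitary W \<and> B = W ** A ** adjm W)"

lemma unitarily_similar_if_same_spectral_values:
  assumes "spectral_decomp A U d" "spectral_decomp B V d"
  shows "unitarily_similar A B"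
proof -
  let ?D = "diagm (\<lambda>i. complex_of_real (d i))"
  have U: "unitary U" and V: "unitary V" and A: "A = U ** ?D ** adjm U" and B: "B = V ** ?D ** adjm V"
    using assms by (auto simp: spectral_decomp_def)
  have "B = (V ** adjm U) ** (U ** ?D ** adjm U) ** adjm (V ** adjm U)"
    using unitary_left_inverse[OF U] B
    by (simp add: adjm_mult matrix_mul_assoc) (metis matrix_mul_assoc matrix_mul_lid matrix_mul_rid)
  then show ?thesis
    unfolding unitarily_similar_def A using U V by (blast intro: unitary_mult unitary_adjm)
qed

lemma positive_unitarily_similar_if_trace_matpow_eq:
  assumes "positive A" "positive B" "\<And>k. trace (matpow A k) = trace (matpow B k)"
  shows "unitarily_similar A B"
proof -
  obtain U d where A: "spectral_decomp A U d" using assms(1) positive_spectral_decomp by blast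
  obtain V e where B: "spectral_decomp B V e" using assms(2) positive_spectral_decomp by blast
  have "\<forall>k. (\<Sum>i\<in>UNIV. d i ^ k) = (\<Sum>i\<in>UNIV. e i ^ k)"
    using assms(3) trace_matpow_spectral_decomp[OF A] trace_matpow_spectral_decomp[OF B]
    by (metis of_real_eq_iff)
  then have "card {i. d i = l} = card {i. e i = l}" for l
    by (rule card_fiber_eq_if_power_sums_eq)
  then obtain \<sigma> where "inj \<sigma>" "\<forall>i. e i = d (\<sigma> i)"
    using exists_inj_reindex_if_card_fibers_eq by blast
  then have "inj \<sigma>" "e = d \<circ> \<sigma>" by auto
  then show ?thesis
    using unitarily_similar_if_same_spectral_values spectral_decomp_reindex A B by metis
qed

section \<open>Invariants of unitary conjugation\<close>

lemma is_eigenvalue_unitary_conj_imp: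
  assumes W: "unitary W" and "is_eigenvalue A z"
  shows "is_eigenvalue (W ** A ** adjm W) z"
proof -
  obtain v where v: "v \<noteq> 0" "A *v v = z *s v"
    using assms(2) by (auto simp: is_eigenvalue_def vec_eq_iff)
  have "W *v v \<noteq> 0" using v(1) unitary_vec_cancel[OF W, of v] by auto
  moreover have "(W ** A ** adjm W) *v (W *v v) = z *s (W *v v)"
    by (simp add: unitary_vec_cancel[OF W] v(2) vector_scalar_commute flip: matrix_vector_mul_assoc)
  ultimately show ?thesis by (auto simp: is_eigenvalue_def vec_eq_iff)
qed

lemma is_eigenvalue_unitary_conj:
  assumes W: "unitary W"
  shows "is_eigenvalue (W ** A ** adjm W) z \<longleftrightarrow> is_eigenvalue A z"
proof
  assume "is_eigenvalue (W ** A ** adjm W) z"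
  then have "is_eigenvalue (adjm W ** (W ** A ** adjm W) ** adjm (adjm W)) z"
    by (rule is_eigenvalue_unitary_conj_imp[OF unitary_adjm[OF W]])
  then show "is_eigenvalue A z"
    by (simp only: adjm_adjm unitary_conj_cancel[OF W])
qed (rule is_eigenvalue_unitary_conj_imp[OF W])

definition const_poly_matrix :: "complex^'n^'n \<Rightarrow> complex poly^'n^'n" where
  "const_poly_matrix M = (\<chi> i j. [:M $ i $ j:])"

lemma const_poly_matrix_mult:
  "const_poly_matrix (A ** B) = const_poly_matrix A ** const_poly_matrix B"
proof -
  have const_sum: "(\<Sum>k\<in>S. [:f k:]) = [:\<Sum>k\<in>S. f k:]" for S and f :: "'n \<Rightarrow> complex"
    by (induction S rule: infinite_finite_induct) simp_all
  have "[:\<Sum>k\<in>UNIV. A $ i $ k * B $ k $ j:] = (\<Sum>k\<in>UNIV. [:A $ i $ k:] * [:B $ k $ j:])" for i j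
    by (simp add: const_sum mult_ac)
  then show ?thesis
    by (simp add: const_poly_matrix_def vec_eq_iff matrix_matrix_mult_def)
qed

lemma const_poly_matrix_one: "const_poly_matrix (mat 1) = mat 1"
  by (simp add: const_poly_matrix_def vec_eq_iff mat_def)

lemma charpoly_eq_det: "charpoly A = det (mat [:0, 1:] - const_poly_matrix A)"
  unfolding charpoly_def const_poly_matrix_def mat_def by (rule arg_cong[of _ _ det]) (simp add: vec_eq_iff)

lemma matrix_mult_mat_commute: "(M::'a::comm_ring_1^'n^'n) ** mat x = mat x ** M"
  by (simp add: vec_eq_iff matrix_matrix_mult_def mat_def if_distrib if_distribR mult.commute cong: if_cong)

lemma charpoly_unitary_conj:
  assumes W: "unitary W"
  shows "charpoly (W ** A ** adjm W) = charpoly A"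
proof -
  let ?X = "mat [:0, 1:] :: complex poly^'n^'n"
  let ?W = "const_poly_matrix W" and ?W' = "const_poly_matrix (adjm W)"
  have WW': "?W ** ?W' = mat 1"
    by (simp only: const_poly_matrix_mult[symmetric] unitary_right_inverse[OF W] const_poly_matrix_one)
  have "?W ** ?X ** ?W' = ?X ** (?W ** ?W')"
    by (simp only: matrix_mult_mat_commute[of ?W] matrix_mul_assoc)
  then have X: "?W ** ?X ** ?W' = ?X"
    by (simp only: WW' matrix_mul_rid)
  have "?W ** (?X - const_poly_matrix A) ** ?W' = ?W ** ?X ** ?W' - const_poly_matrix (W ** A ** adjm W)"
    by (simp only: matrix_diff_ldistrib matrix_diff_rdistrib const_poly_matrix_mult)
  then have "?X - const_poly_matrix (W ** A ** adjm W) = ?W ** (?X - const_poly_matrix A) ** ?W'"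
    by (simp only: X)
  then have "charpoly (W ** A ** adjm W) = det ?W * det (?X - const_poly_matrix A) * det ?W'"
    by (simp only: charpoly_eq_det det_mul)
  also have "\<dots> = det (?X - const_poly_matrix A) * det (?W ** ?W')"
    by (simp only: det_mul mult_ac)
  finally show ?thesis
    by (simp only: WW' det_I mult_1_right charpoly_eq_det)
qed

lemma norm_unitary: "unitary W \<Longrightarrow> norm (W *v v) = norm v"
  unfolding norm_eq_sqrt_cinner by (simp add: cinner_adjm unitary_vec_cancel)

lemma opnorm_unitary_conj:
  assumes W: "unitary W"
  shows "opnorm (W ** A ** adjm W) = opnorm A"
proof -
  let ?g = "\<lambda>y. norm (A *v y) / norm y"
  have "(\<lambda>x. norm ((W ** A ** adjm W) *v x) / norm x) = ?g \<circ> (\<lambda>x. adjm W *v x)"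
  proof
    fix x
    have "norm ((W ** A ** adjm W) *v x) = norm (A *v (adjm W *v x))"
      by (simp add: norm_unitary[OF W] flip: matrix_vector_mul_assoc)
    moreover have "norm x = norm (adjm W *v x)"
      using norm_unitary[OF unitary_adjm[OF W], of x] by simp
    ultimately show "norm ((W ** A ** adjm W) *v x) / norm x = (?g \<circ> (\<lambda>x. adjm W *v x)) x"
      by simp
  qed
  moreover have "surj (\<lambda>x. adjm W *v x)"
    by (metis surjI unitary_vec_cancel[OF W])
  ultimately show ?thesis
    unfolding opnorm_def onorm_def by (simp only: image_comp[symmetric])
qed

lemma spectral_decomp_adjm_mult_self:
  assumes "spectral_decomp A U d"
  shows "spectral_decomp (adjm A ** A) U (\<lambda>i. d i * d i)"
proof -
  have "adjm A = A"
    using assms by (auto simp: spectral_decomp_def adjm_mult matrix_mul_assoc)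
  then show ?thesis
    using spectral_decomp_mult[OF assms assms] assms by (simp add: spectral_decomp_def)
qed

lemma snorm_unitary_conj:
  assumes A: "spectral_decomp A U d" and W: "unitary W"
  shows "snorm s (W ** A ** adjm W) = snorm s A"
proof -
  have "adjm (W ** A ** adjm W) ** (W ** A ** adjm W) = W ** adjm A ** (adjm W ** W) ** A ** adjm W"
    by (simp add: adjm_mult matrix_mul_assoc)
  also have "\<dots> = W ** (adjm A ** A) ** adjm W"
    by (simp add: unitary_left_inverse[OF W] matrix_mul_assoc)
  finally have "mabs (W ** A ** adjm W) = W ** mabs A ** adjm W"
    by (simp only: mabs_def mpow_conj[OF spectral_decomp_adjm_mult_self[OF A] W])
  moreover have "spectral_decomp (mabs A) U (\<lambda>i. (d i * d i) powr (1/2))"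
    unfolding mabs_def by (rule spectral_decomp_mpow[OF spectral_decomp_adjm_mult_self[OF A]])
  ultimately show ?thesis
    by (simp only: snorm_def mpow_conj[OF _ W] tau_def trace_unitary_conj[OF W])
qed

theorem mainTheorem3:
  fixes n :: nat and K :: "complex^'n^'n" and b :: "real \<Rightarrow> complex^'n^'n"
    and I :: "real set" and s :: real
  defines "p \<equiv> 2 * real n"
  defines "q \<equiv> p / (p - 1)"
  defines "\<alpha> \<equiv> q / 2"
  assumes n: "n \<ge> 1"
    and skew: "adjm K = - K"
    and I: "is_interval I"
    and pos: "\<forall>t\<in>I. positive (b t)"
    and deriv: "\<forall>t\<in>I. (b has_vector_derivative
                   (mpow (b t) \<alpha> ** K - K ** mpow (b t) \<alpha>)) (at t within I)"
    and C1: "continuous_on I (\<lambda>t. mpow (b t) \<alpha> ** K - K ** mpow (b t) \<alpha>)"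
    and s: "s \<ge> 1"
  shows "\<forall>t1\<in>I. \<forall>t2\<in>I.
           snorm s (b t1) = snorm s (b t2) \<and>
           {z. is_eigenvalue (b t1) z} = {z. is_eigenvalue (b t2) z} \<and>
           (\<forall>z. eig_mult (b t1) z = eig_mult (b t2) z) \<and>
           opnorm (b t1) = opnorm (b t2)"
proof (intro ballI)
  fix t1 t2 assume t1: "t1 \<in> I" and t2: "t2 \<in> I"
  have "\<forall>t\<in>I. mpow (b t) \<alpha> ** b t = b t ** mpow (b t) \<alpha>"
    using pos positive_spectral_decomp mpow_commute by metis
  then have "trace (matpow (b t1) k) = trace (matpow (b t2) k)" for k
    using trace_matpow_constant[OF I _ deriv t1 t2] by blast
  then obtain W where W: "unitary W" and b2: "b t2 = W ** b t1 ** adjm W"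
    using positive_unitarily_similar_if_trace_matpow_eq pos t1 t2
    unfolding unitarily_similar_def by metis
  obtain U d where "spectral_decomp (b t1) U d"
    using pos t1 positive_spectral_decomp by blast
  then show "snorm s (b t1) = snorm s (b t2) \<and>
           {z. is_eigenvalue (b t1) z} = {z. is_eigenvalue (b t2) z} \<and>
           (\<forall>z. eig_mult (b t1) z = eig_mult (b t2) z) \<and>
           opnorm (b t1) = opnorm (b t2)"
    unfolding b2 eig_mult_def
    by (simp add: snorm_unitary_conj W is_eigenvalue_unitary_conj charpoly_unitary_conj
        opnorm_unitary_conj)
qed

end
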